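(* Let $n$ be a positive integer. For each integer $t\ge0$ let $A_t$ be a row-stochastic matrix and $\mathcal{E}_t$ a real diagonal matrix, both of size $n$, let $B_t=A_t-\mathcal{E}_t$, let $V_t\in\mathbb{R}^n$ be given by $V_t(i)=|A_t(i,i)-\mathcal{E}_t(i)|$, and let $\tau_t,\tau'_t$ be real numbers such that $0\le\tau'_t<\tau_t\le n$. Suppose that for each integer $t\ge0$, $$\mathrm{tr}\,A_t-\mathbf{1}^\top V_t\ge\tau_t\quad\text{and}\quad|B_t(i,j)|\le\frac{1}{n-\tau'_t}\ \text{ for all } i,j\in\{1,\dots,n\}.$$ Suppose also that $$\prod_{s=0}^{\lfloor t/2\rfloor-1}\frac{n-\tau_{2s+f(t)}}{n-\tau'_{2s+f(t)+1}}\xrightarrow[t\to\infty]{}0,\qquad(\ast)$$ where $f(t)=0$ if $t$ is even and $f(t)=1$ otherwise. Let $Y_0\in\mathbb{R}^n$ and $Y_{t+1}=B_tY_t$ for all $t\ge0$. Then $\lim_{t\to\infty}Y_t=0$. In particular, $(\ast)$ is satisfied if there exist $\gamma_0,\gamma_1\in\mathbb{R}$ such that for all $t\ge0$, $0\le\tau'_t\le\gamma_0<\gamma_1\le\tau_t\le n$.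
   Context: A nonnegative real square matrix is row stochastic if each row-sum equals $1$. $\mathbf{1}$ is the all-ones vector in $\mathbb{R}^n$; $\mathcal{E}_t(i)$ is the $i$-th diagonal entry of $\mathcal{E}_t$. In the paper, $Y_t=X_t-\bar\sigma$ is the error of the dynamics $X_{t+1}=A_tX_t+\mathcal{E}_t(\bar\sigma-X_t)$ with $\bar\sigma$ a multiple of $\mathbf{1}$, which is equivalent to $Y_{t+1}=B_tY_t$. *)

theory Defs
  imports "HOL-Analysis.Analysis"
begin

definition row_stochastic :: "real^'n^'n \<Rightarrow> bool" where
  "row_stochastic A \<longleftrightarrow> (\<forall>i j. 0 \<le> A $ i $ j) \<and> (\<forall>i. (\<Sum>j\<in>UNIV. A $ i $ j) = 1)"

definition diagonal_mat :: "real^'n^'n \<Rightarrow> bool" where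
  "diagonal_mat D \<longleftrightarrow> (\<forall>i j. i \<noteq> j \<longrightarrow> D $ i $ j = 0)"

definition parity_offset :: "nat \<Rightarrow> nat" where
  "parity_offset t = (if even t then 0 else 1)"

definition pair_product :: "nat \<Rightarrow> (nat \<Rightarrow> real) \<Rightarrow> (nat \<Rightarrow> real) \<Rightarrow> nat \<Rightarrow> real" where
  "pair_product n \<tau> \<tau>' t =
     (\<Prod>s<t div 2. (real n - \<tau> (2 * s + parity_offset t)) /
                   (real n - \<tau>' (2 * s + parity_offset t + 1)))"

end

theory Submission
  imports Defs
begin

text \<open>
  The absolute entries of \<open>B\<^sub>t\<close> sum to \<open>n - tr A\<^sub>t + \<Sum>V\<^sub>t\<close>, which is at most \<open>n - \<tau>\<^sub>t\<close>, so \<open>B\<^sub>t\<close> maps the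
  sup norm to the 1-norm with operator norm at most \<open>n - \<tau>\<^sub>t\<close>. The bound on the individual entries
  says that \<open>B\<^sub>t\<close> maps the 1-norm to the sup norm with operator norm at most \<open>1 / (n - \<tau>'\<^sub>t)\<close>.
  Alternating the two estimates, each pair of steps contracts the sup norm by one factor of
  \<open>(\<ast>)\<close>; the offset \<open>f(t)\<close> makes the number of steps taken before time \<open>t\<close> even.
\<close>

lemma sum_abs_matrix_vector_mult_le:
  fixes B :: "real^'n^'m"
  assumes "\<And>j. \<bar>x $ j\<bar> \<le> M"
  shows "(\<Sum>i\<in>UNIV. \<bar>(B *v x) $ i\<bar>) \<le> (\<Sum>i\<in>UNIV. \<Sum>j\<in>UNIV. \<bar>B $ i $ j\<bar>) * M"
proof -
  have "\<bar>(B *v x) $ i\<bar> \<le> (\<Sum>j\<in>UNIV. \<bar>B $ i $ j\<bar>) * M" for i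
  proof -
    have "\<bar>(B *v x) $ i\<bar> \<le> (\<Sum>j\<in>UNIV. \<bar>B $ i $ j * x $ j\<bar>)"
      by (simp add: matrix_vector_mult_def sum_abs)
    also have "\<dots> \<le> (\<Sum>j\<in>UNIV. \<bar>B $ i $ j\<bar> * M)"
      by (intro sum_mono) (simp add: abs_mult assms mult_left_mono)
    finally show ?thesis by (simp add: sum_distrib_right)
  qed
  then show ?thesis
    unfolding sum_distrib_right[of _ UNIV M] by (intro sum_mono) (simp add: sum_distrib_right)
qed

lemma abs_matrix_vector_mult_le:
  fixes B :: "real^'n^'m"
  assumes "\<And>i j. \<bar>B $ i $ j\<bar> \<le> b"
  shows "\<bar>(B *v x) $ i\<bar> \<le> b * (\<Sum>j\<in>UNIV. \<bar>x $ j\<bar>)"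
proof -
  have "\<bar>(B *v x) $ i\<bar> \<le> (\<Sum>j\<in>UNIV. \<bar>B $ i $ j * x $ j\<bar>)"
    by (simp add: matrix_vector_mult_def sum_abs)
  also have "\<dots> \<le> (\<Sum>j\<in>UNIV. b * \<bar>x $ j\<bar>)"
    by (intro sum_mono) (simp add: abs_mult assms mult_right_mono)
  finally show ?thesis by (simp add: sum_distrib_left)
qed

text \<open>Off the diagonal \<open>A - D\<close> agrees with the nonnegative matrix
  \<open>A\<close>, so there row \<open>i\<close> contributes its row sum 1 minus
  \<open>A $ i $ i\<close>. The diagonal entry adds its own absolute value, and the terms
  \<open>A $ i $ i\<close> add up to the trace.\<close>

lemma sum_abs_row_stochastic_minus_diagonal:
  fixes A D :: "real^'n^'n"
  assumes A: "row_stochastic A" and D: "diagonal_mat D"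
  shows "(\<Sum>i\<in>UNIV. \<Sum>j\<in>UNIV. \<bar>(A - D) $ i $ j\<bar>) =
    real CARD('n) - trace A + (\<Sum>i\<in>UNIV. \<bar>A $ i $ i - D $ i $ i\<bar>)"
proof -
  have "(\<Sum>j\<in>UNIV. \<bar>(A - D) $ i $ j\<bar>) = 1 - A $ i $ i + \<bar>A $ i $ i - D $ i $ i\<bar>" for i
  proof -
    have "(\<Sum>j\<in>UNIV - {i}. \<bar>(A - D) $ i $ j\<bar>) = (\<Sum>j\<in>UNIV - {i}. A $ i $ j)"
      using A D by (intro sum.cong) (auto simp: row_stochastic_def diagonal_mat_def)
    moreover have "(\<Sum>j\<in>UNIV. A $ i $ j) = 1"
      using A by (simp add: row_stochastic_def)
    ultimately show ?thesis
      by (simp add: sum.remove[of UNIV i])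
  qed
  then show ?thesis
    by (simp add: trace_def sum.distrib sum_subtractf)
qed

text \<open>A uniform gap between \<open>\<gamma>\<^sub>0\<close> and
  \<open>\<gamma>\<^sub>1\<close> keeps every factor in an interval \<open>[0, r]\<close> with
  \<open>r < 1\<close>, so the product decays geometrically in \<open>t div 2\<close>.\<close>

lemma pair_product_tendsto_0:
  assumes "\<And>t. \<tau>' t \<le> \<gamma>\<^sub>0" "\<And>t. \<gamma>\<^sub>1 \<le> \<tau> t" "\<And>t. \<tau> t \<le> real n" "\<gamma>\<^sub>0 < \<gamma>\<^sub>1"
  shows "pair_product n \<tau> \<tau>' \<longlonglongrightarrow> 0"
proof -
  define r where "r = (real n - \<gamma>\<^sub>1) / (real n - \<gamma>\<^sub>0)"
  have "\<gamma>\<^sub>1 \<le> real n" using assms(2,3) order_trans by blast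
  with \<open>\<gamma>\<^sub>0 < \<gamma>\<^sub>1\<close> have r: "0 \<le> r" "r < 1" by (auto simp: r_def)
  \<comment> \<open>Numerators are at most \<open>n - \<gamma>\<^sub>1\<close>, denominators at
    least \<open>n - \<gamma>\<^sub>0 > 0\<close>. Taking the times \<open>k\<close> and
    \<open>l\<close> arbitrary covers both parities at once.\<close>
  have factor: "0 \<le> (real n - \<tau> k) / (real n - \<tau>' l) \<and>
      (real n - \<tau> k) / (real n - \<tau>' l) \<le> r" for k l
    unfolding r_def using assms(1)[of l] assms(2,3)[of k] assms(4)
    by (intro conjI divide_nonneg_nonneg frac_le) auto
  have bounds: "0 \<le> pair_product n \<tau> \<tau>' t \<and> pair_product n \<tau> \<tau>' t \<le> r ^ (t div 2)" for t
  proof -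
    have "pair_product n \<tau> \<tau>' t \<le> (\<Prod>s<t div 2. r)"
      unfolding pair_product_def using factor by (intro prod_mono) blast
    then show ?thesis
      unfolding pair_product_def using factor by (auto intro: prod_nonneg)
  qed
  have "filterlim (\<lambda>t::nat. t div 2) sequentially sequentially"
    unfolding filterlim_at_top
  proof
    fix Z :: nat
    show "\<forall>\<^sub>F t in sequentially. Z \<le> t div 2"
      using eventually_ge_at_top[of "2 * Z"] by eventually_elim linarith
  qed
  then have "(\<lambda>t. r ^ (t div 2)) \<longlonglongrightarrow> 0"
    using filterlim_compose[OF LIMSEQ_realpow_zero[OF r]] by blast
  then show ?thesis
    by (rule tendsto_sandwich[OF _ _ tendsto_const, rotated 2]) (use bounds in auto)
qed

theorem theorem3p8:
  fixes A \<E> B :: "nat \<Rightarrow> real^'n^'n"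
    and V Y :: "nat \<Rightarrow> real^'n"
    and \<tau> \<tau>' :: "nat \<Rightarrow> real"
  assumes "\<And>t. row_stochastic (A t)"
    and "\<And>t. diagonal_mat (\<E> t)"
    and "\<And>t. B t = A t - \<E> t"
    and "\<And>t. V t = (\<chi> i. \<bar>A t $ i $ i - \<E> t $ i $ i\<bar>)"
    and "\<And>t. 0 \<le> \<tau>' t \<and> \<tau>' t < \<tau> t \<and> \<tau> t \<le> real CARD('n)"
    and "\<And>t. trace (A t) - (1 :: real^'n) \<bullet> V t \<ge> \<tau> t"
    and "\<And>t i j. \<bar>B t $ i $ j\<bar> \<le> 1 / (real CARD('n) - \<tau>' t)"
    and "\<And>t. Y (Suc t) = B t *v Y t"
  shows "(pair_product CARD('n) \<tau> \<tau>' \<longlonglongrightarrow> 0 \<longrightarrow> Y \<longlonglongrightarrow> 0) \<and>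
    ((\<exists>\<gamma>\<^sub>0 \<gamma>\<^sub>1 :: real. \<forall>t. 0 \<le> \<tau>' t \<and> \<tau>' t \<le> \<gamma>\<^sub>0 \<and> \<gamma>\<^sub>0 < \<gamma>\<^sub>1 \<and> \<gamma>\<^sub>1 \<le> \<tau> t \<and> \<tau> t \<le> real CARD('n))
       \<longrightarrow> pair_product CARD('n) \<tau> \<tau>' \<longlonglongrightarrow> 0)"
proof (intro conjI impI)
  let ?n = "real CARD('n)"
  \<comment> \<open>The inner product of the all-ones vector with \<open>V t\<close> is the sum of
    the absolute diagonal entries of \<open>B t\<close>, so the trace hypothesis bounds the exact
    total computed above.\<close>
  have total: "(\<Sum>i\<in>UNIV. \<Sum>j\<in>UNIV. \<bar>B t $ i $ j\<bar>) \<le> ?n - \<tau> t" for t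
    using sum_abs_row_stochastic_minus_diagonal[OF assms(1,2), of t t] assms(3,4,6)[of t]
    by (simp add: inner_vec_def)
  have two_steps: "\<bar>Y (Suc (Suc t)) $ i\<bar> \<le> M * ((?n - \<tau> t) / (?n - \<tau>' (Suc t)))"
    if M: "\<And>j. \<bar>Y t $ j\<bar> \<le> M" for t M i
  proof -
    \<comment> \<open>Any index would do here: \<open>M\<close> dominates an absolute value.\<close>
    have "0 \<le> M" using M[of undefined] by linarith
    have "\<bar>Y (Suc (Suc t)) $ i\<bar> \<le> 1 / (?n - \<tau>' (Suc t)) * (\<Sum>j\<in>UNIV. \<bar>Y (Suc t) $ j\<bar>)"
      unfolding assms(8)[of "Suc t"] by (rule abs_matrix_vector_mult_le[OF assms(7)])
    also have "\<dots> \<le> 1 / (?n - \<tau>' (Suc t)) * ((?n - \<tau> t) * M)"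
    proof (rule mult_left_mono)
      have "(\<Sum>j\<in>UNIV. \<bar>Y (Suc t) $ j\<bar>) \<le> (\<Sum>i\<in>UNIV. \<Sum>j\<in>UNIV. \<bar>B t $ i $ j\<bar>) * M"
        unfolding assms(8)[of t] by (rule sum_abs_matrix_vector_mult_le[OF M])
      also have "\<dots> \<le> (?n - \<tau> t) * M"
        using total \<open>0 \<le> M\<close> by (rule mult_right_mono)
      finally show "(\<Sum>j\<in>UNIV. \<bar>Y (Suc t) $ j\<bar>) \<le> (?n - \<tau> t) * M" .
      \<comment> \<open>The denominator is positive because \<tau>' < \<tau> \<le> n at each
        time.\<close>
      show "0 \<le> 1 / (?n - \<tau>' (Suc t))" using assms(5)[of "Suc t"] by simp
    qed
    finally show ?thesis by (simp add: field_simps)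
  qed
  have even_steps: "\<bar>Y (2 * m + f) $ i\<bar> \<le>
      norm (Y f) * (\<Prod>s<m. (?n - \<tau> (2 * s + f)) / (?n - \<tau>' (2 * s + f + 1)))" for m f i
  proof (induction m arbitrary: i)
    case 0
    then show ?case by (simp add: component_le_norm_cart)
  next
    case (Suc m)
    \<comment> \<open>The induction hypothesis holds for every component, so it is the sup norm
      bound that \<open>two_steps\<close> asks for; the two new steps supply the factor with
      \<open>s = m\<close>.\<close>
    from two_steps[of "2 * m + f", OF this, of i] show ?case
      by (simp add: mult.assoc)
  qed
  {
    assume lim: "pair_product CARD('n) \<tau> \<tau>' \<longlonglongrightarrow> 0"
    \<comment> \<open>The starting time is 0 or 1 according to the parity of \<open>t\<close>; the
      sum of the two norms serves both cases with one constant.\<close>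
    define K where "K = norm (Y 0) + norm (Y 1)"
    have "\<bar>Y t $ i\<bar> \<le> K * \<bar>pair_product CARD('n) \<tau> \<tau>' t\<bar>" for t i
    proof -
      have t: "2 * (t div 2) + parity_offset t = t"
        by (simp add: parity_offset_def)
      have "\<bar>Y t $ i\<bar> \<le> norm (Y (parity_offset t)) * pair_product CARD('n) \<tau> \<tau>' t"
        using even_steps[of "t div 2" "parity_offset t" i] unfolding t pair_product_def .
      \<comment> \<open>Passing to the absolute value provides the nonnegative factor needed to
        enlarge the norm to \<open>K\<close>.\<close>
      also have "\<dots> \<le> norm (Y (parity_offset t)) * \<bar>pair_product CARD('n) \<tau> \<tau>' t\<bar>"
        by (intro mult_left_mono) auto
      also have "\<dots> \<le> K * \<bar>pair_product CARD('n) \<tau> \<tau>' t\<bar>"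
        by (intro mult_right_mono) (auto simp: K_def parity_offset_def)
      finally show ?thesis .
    qed
    moreover have "(\<lambda>t. K * \<bar>pair_product CARD('n) \<tau> \<tau>' t\<bar>) \<longlonglongrightarrow> 0"
      using tendsto_mult_right_zero[OF tendsto_rabs_zero[OF lim]] .
    ultimately have "(\<lambda>t. Y t $ i) \<longlonglongrightarrow> 0" for i
      by (intro Lim_null_comparison[of "\<lambda>t. Y t $ i"] always_eventually) simp_all
    then show "Y \<longlonglongrightarrow> 0" by (intro vec_tendstoI) simp
  }
  show "pair_product CARD('n) \<tau> \<tau>' \<longlonglongrightarrow> 0"
    if "\<exists>\<gamma>\<^sub>0 \<gamma>\<^sub>1 :: real. \<forall>t. 0 \<le> \<tau>' t \<and> \<tau>' t \<le> \<gamma>\<^sub>0 \<and> \<gamma>\<^sub>0 < \<gamma>\<^sub>1 \<and> \<gamma>\<^sub>1 \<le> \<tau> t \<and> \<tau> t \<le> ?n"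
    using that by (auto intro: pair_product_tendsto_0)
qed

end
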